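(* Let $0<\lambda<1$ and $\delta>0$, and let $$m^*=m(\lambda,\delta)=\min\Big\{m:\lambda<1-\Big(\tfrac1{1+\delta}\Big)^{m+1}\Big\}=\max\Big\{m:\lambda\ge1-\Big(\tfrac1{1+\delta}\Big)^{m}\Big\}=\Big\lfloor-\frac{\log(1-\lambda)}{\log(1+\delta)}\Big\rfloor,$$ where $m$ ranges over the nonnegative integers. Put $a=\frac1{1+\delta}$ and $b=\frac1{1+\delta+\nu}$. The fixed point $y^*$ of the asynchronous fluid limit is given by $$y^*_{0,m^*}=\frac{ab^{m^*-1}\delta}{(1+\nu)(\delta+\nu)},\qquad y^*_{i,m^*}=\frac{ab^{m^*-i}\delta}{1+\nu},\quad i=1,\dots,m^*,$$ $$y^*_{0,m^*+1}=a^{m^*+1}-\frac{a^2b^{m^*-1}\delta}{(1+\nu)(\delta+\nu)},\qquad y^*_{1,m^*+1}=\delta\Big(a^{m^*+1}-\frac{a^2b^{m^*-1}\delta}{(1+\nu)(\delta+\nu)}\Big),$$ $$y^*_{i,m^*+1}=\delta\Big(a^{m^*+2-i}-\frac{ab^{m^*+1-i}}{1+\nu}\Big),\quad i=2,\dots,m^*+1,$$ and $y^*_{i,j}=0$ when $j\ne m^*,m^*+1$, where $\nu\ge0$ is the unique solution of the equation $y^*_{0,m^*}+y^*_{0,m^*+1}=1-\lambda$, i.e., $$h(\nu)=a^{m^*+1}+\frac{a^2b^{m^*-1}\delta^2}{(1+\nu)(\delta+\nu)}=1-\lambda .$$ In particular, if $\lambda=1-(1+\delta)^{-m^*}$, i.e.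 $m^*=-\frac{\log(1-\lambda)}{\log(1+\delta)}$, then $\nu=0$, so $y^*_{0,m^*}=\left(\frac1{1+\delta}\right)^{m^*}=1-\lambda$, $$y^*_{i,m^*}=\delta\Big(\frac1{1+\delta}\Big)^{m^*+1-i}=\big(1-(1-\lambda)^{1/m^*}\big)(1-\lambda)^{\frac{m^*-i}{m^*}},\quad i=1,\dots,m^*,$$ and $y^*_{i,m^*+1}=0$ for all $i=0,\dots,m^*+1$.
   Context: A state is an array $y=(y_{i,j})_{0\le i\le j}$ of nonnegative reals with $\sum_{0\le i\le j}y_{i,j}=1$; $y_{i,j}$ is the fraction of servers with queue length $i$ and queue estimate $j$. For a state $y$ put $v_i=\sum_{l\ge i}y_{i,l}$, $w_j=\sum_{k=0}^{j}y_{k,j}$, $m=\min\{j:w_j>0\}$, and $u_k=\delta\sum_{i=0}^{k-1}(k-i)v_i$. Let $n=m$ if $u_m\le\lambda$, and otherwise let $n=\max\{k:u_k\le\lambda\}\le m-1$. Put $\zeta=\lambda-u_n$ and $q_{i,j}=\frac{y_{i,j}}{w_j}\mathbf 1\{n=j\}$ (interpreted as $0$ if $w_j=0$). The asynchronous fluid limit (exponential update intervals with rate $\delta$ at each server, arrival rate $\lambda$ per server, unit-mean exponential service) is governed by the system, for all $0\le i\le j$ with $j\ge n(t)$, $$\frac{dy_{i,j}(t)}{dt}=y_{i+1,j}\mathbf 1\{i<j\}-y_{i,j}\mathbf 1\{i>0\}+\zeta q_{i-1,j-1}\mathbf 1\{i>0\}-\zeta q_{i,j}+\delta\sum_{k=0}^{n-1}v_k\,\mathbf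 1\{i=j=n\}+\delta v_i\mathbf 1\{i=j\ge n\}-\delta y_{i,j},$$ where all quantities on the right are evaluated at time $t$. A fixed point is a state $y$ for which the right-hand side vanishes for all $0\le i\le j$ with $j\ge n$. *)

theory Defs
  imports Complex_Main "HOL-Analysis.Infinite_Sum"
begin

text \<open>
  A state is an array \<open>y i j\<close> indexed by \<open>i \<le> j\<close>.  It is modelled by a total function; the values
  at \<open>i > j\<close> are irrelevant and are never read by the definitions below.
\<close>

definition is_state :: "(nat \<Rightarrow> nat \<Rightarrow> real) \<Rightarrow> bool" where
  "is_state y \<longleftrightarrow>
     (\<forall>i j. i \<le> j \<longrightarrow> 0 \<le> y i j) \<and> ((\<lambda>(i, j). y i j) has_sum 1) {(i, j). i \<le> j}"

definition len_frac :: "(nat \<Rightarrow> nat \<Rightarrow> real) \<Rightarrow> nat \<Rightarrow> real" where \<comment> \<open>\<open>v\<^sub>i\<close>\<close>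
  "len_frac y i = (\<Sum>\<^sub>\<infinity>l\<in>{i..}. y i l)"

definition est_frac :: "(nat \<Rightarrow> nat \<Rightarrow> real) \<Rightarrow> nat \<Rightarrow> real" where \<comment> \<open>\<open>w\<^sub>j\<close>\<close>
  "est_frac y j = (\<Sum>k=0..j. y k j)"

definition min_est :: "(nat \<Rightarrow> nat \<Rightarrow> real) \<Rightarrow> nat" where \<comment> \<open>\<open>m\<close>\<close>
  "min_est y = (LEAST j. 0 < est_frac y j)"

definition fill_rate :: "real \<Rightarrow> (nat \<Rightarrow> nat \<Rightarrow> real) \<Rightarrow> nat \<Rightarrow> real" where \<comment> \<open>\<open>u\<^sub>k\<close>\<close>
  "fill_rate \<delta> y k = \<delta> * (\<Sum>i<k. real (k - i) * len_frac y i)"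

text \<open>
  For a state whose \<open>u\<^sub>m\<close> exceeds \<open>lam \<ge> 0\<close>, the set below contains \<open>0\<close> and, since \<open>u\<close> is
  nondecreasing, is bounded by \<open>m - 1\<close>; so \<open>Max\<close> is taken over a finite nonempty set.
\<close>

definition level :: "real \<Rightarrow> real \<Rightarrow> (nat \<Rightarrow> nat \<Rightarrow> real) \<Rightarrow> nat" where \<comment> \<open>\<open>n\<close>\<close>
  "level lam \<delta> y =
     (if fill_rate \<delta> y (min_est y) \<le> lam then min_est y
      else Max {k. fill_rate \<delta> y k \<le> lam})"

definition excess :: "real \<Rightarrow> real \<Rightarrow> (nat \<Rightarrow> nat \<Rightarrow> real) \<Rightarrow> real" where \<comment> \<open>\<open>\<zeta>\<close>\<close>
  "excess lam \<delta> y = lam - fill_rate \<delta> y (level lam \<delta> y)"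

text \<open>Division by zero yields \<open>0\<close>, which is the required convention when \<open>w\<^sub>j = 0\<close>.\<close>

definition assign_prob ::
    "real \<Rightarrow> real \<Rightarrow> (nat \<Rightarrow> nat \<Rightarrow> real) \<Rightarrow> nat \<Rightarrow> nat \<Rightarrow> real" where \<comment> \<open>\<open>q\<^sub>i\<^sub>,\<^sub>j\<close>\<close>
  "assign_prob lam \<delta> y i j = y i j / est_frac y j * of_bool (level lam \<delta> y = j)"

text \<open>
  The right-hand side of the fluid limit equations.  The truncated differences \<open>i - 1\<close>, \<open>j - 1\<close> only
  matter for \<open>0 < i \<le> j\<close>.
\<close>

definition drift :: "real \<Rightarrow> real \<Rightarrow> (nat \<Rightarrow> nat \<Rightarrow> real) \<Rightarrow> nat \<Rightarrow> nat \<Rightarrow> real" where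
  "drift lam \<delta> y i j =
     (let n = level lam \<delta> y; \<zeta> = excess lam \<delta> y; q = assign_prob lam \<delta> y; v = len_frac y in
        y (i + 1) j * of_bool (i < j)
      - y i j * of_bool (0 < i)
      + \<zeta> * q (i - 1) (j - 1) * of_bool (0 < i)
      - \<zeta> * q i j
      + \<delta> * (\<Sum>k<n. v k) * of_bool (i = j \<and> j = n)
      + \<delta> * v i * of_bool (i = j \<and> n \<le> j)
      - \<delta> * y i j)"

definition fixed_point :: "real \<Rightarrow> real \<Rightarrow> (nat \<Rightarrow> nat \<Rightarrow> real) \<Rightarrow> bool" where
  "fixed_point lam \<delta> y \<longleftrightarrow>
     is_state y \<and> (\<forall>i j. i \<le> j \<and> level lam \<delta> y \<le> j \<longrightarrow> drift lam \<delta> y i j = 0)"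

definition mstar :: "real \<Rightarrow> real \<Rightarrow> nat" where
  "mstar lam \<delta> = (LEAST m. lam < 1 - (1 / (1 + \<delta>)) ^ (m + 1))"

text \<open>
  The closed form, with the level \<open>m\<close> and the parameter \<open>\<nu>\<close> left free.  The exponent \<open>m - 1\<close> of
  \<open>b\<close> equals \<open>-1\<close> for \<open>m = 0\<close>, hence the integer power; all other exponents are nonnegative.
\<close>

definition ystar :: "real \<Rightarrow> nat \<Rightarrow> real \<Rightarrow> nat \<Rightarrow> nat \<Rightarrow> real" where
  "ystar \<delta> m \<nu> i j =
     (let a = 1 / (1 + \<delta>); b = 1 / (1 + \<delta> + \<nu>) in
      if j = m then
        (if i = 0 then a * b powi (int m - 1) * \<delta> / ((1 + \<nu>) * (\<delta> + \<nu>))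
         else if i \<le> m then a * b ^ (m - i) * \<delta> / (1 + \<nu>)
         else 0)
      else if j = m + 1 then
        (if i = 0 then
           a ^ (m + 1) - a\<^sup>2 * b powi (int m - 1) * \<delta> / ((1 + \<nu>) * (\<delta> + \<nu>))
         else if i = 1 then
           \<delta> * (a ^ (m + 1) - a\<^sup>2 * b powi (int m - 1) * \<delta> / ((1 + \<nu>) * (\<delta> + \<nu>)))
         else if i \<le> m + 1 then
           \<delta> * (a ^ (m + 2 - i) - a * b ^ (m + 1 - i) / (1 + \<nu>))
         else 0)
      else 0)"

definition hfun :: "real \<Rightarrow> nat \<Rightarrow> real \<Rightarrow> real" where
  "hfun \<delta> m \<nu> =
     (let a = 1 / (1 + \<delta>); b = 1 / (1 + \<delta> + \<nu>) in
      a ^ (m + 1) + a\<^sup>2 * b powi (int m - 1) * \<delta>\<^sup>2 / ((1 + \<nu>) * (\<delta> + \<nu>)))"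

end

theory Submission
  imports Defs "HOL-Analysis.Analysis"
begin

text \<open>
  At a fixed point the level \<open>n\<close> equals \<open>m\<close>: otherwise no server has estimate \<open>n\<close>, the equation at
  \<open>(n, n)\<close> forces \<open>v\<^sub>0 = \<dots> = v\<^sub>n = 0\<close>, and \<open>n\<close> could be increased.  Beyond column \<open>m + 1\<close> no
  jobs arrive, which makes \<open>v\<close> constant and hence zero there.  The remaining two columns satisfy linear
  recurrences with the single parameter \<open>c = \<zeta> / w\<^sub>m\<close>, which determine them; summing the recurrences
  gives \<open>w\<^sub>m + w\<^sub>m\<^sub>+\<^sub>1 = 1\<close> and \<open>v\<^sub>0 + u\<^sub>m + c w\<^sub>m = 1\<close>, so that \<open>\<zeta> = \<lambda> - u\<^sub>m\<close> becomes
  \<open>v\<^sub>0 = 1 - \<lambda>\<close>.  For \<open>m > 0\<close> the closed form solves the recurrences with \<open>c = \<nu>\<close>, and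
  \<open>v\<^sub>0 = h(\<nu>)\<close> decreases strictly from \<open>a\<^sup>m\<close> to its limit \<open>a\<^sup>m\<^sup>+\<^sup>1\<close>, which pins down both \<open>m\<close> and \<open>\<nu>\<close>.
  For \<open>m = 0\<close> the closed form still solves them, but with \<open>c\<close> different from \<open>\<nu>\<close>; there \<open>c\<close> is
  determined by \<open>\<lambda>\<close> directly.
\<close>

section \<open>Arrays supported on two columns\<close>

lemma len_frac_two_columns:
  assumes "\<And>j. i \<le> j \<Longrightarrow> j \<noteq> m \<Longrightarrow> j \<noteq> m + 1 \<Longrightarrow> y i j = 0"
  shows "len_frac y i = (if i \<le> m then y i m else 0) + (if i \<le> m + 1 then y i (m + 1) else 0)"
proof -
  have "len_frac y i = (\<Sum>\<^sub>\<infinity>l\<in>{i..} \<inter> {m, m + 1}. y i l)"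
    unfolding len_frac_def by (rule infsum_cong_neutral) (auto intro!: assms)
  also have "\<dots> = (\<Sum>l\<in>{i..} \<inter> {m, m + 1}. y i l)" by simp
  also have "\<dots> = (\<Sum>l\<in>{m, m + 1}. if i \<le> l then y i l else 0)"
    by (rule sum.mono_neutral_cong_left) auto
  finally show ?thesis by simp
qed

lemma fill_rate_Suc: "fill_rate \<delta> y (Suc k) = fill_rate \<delta> y k + \<delta> * (\<Sum>i\<le>k. len_frac y i)"
proof -
  have "(\<Sum>i<Suc k. real (Suc k - i) * len_frac y i) =
      (\<Sum>i<Suc k. real (k - i) * len_frac y i + len_frac y i)"
    by (rule sum.cong) (simp_all add: Suc_diff_le algebra_simps)
  \<comment> \<open>The term \<open>i = k\<close> has weight \<open>real (k - k) = 0\<close>, so the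
    first sum stops before \<open>k\<close>.\<close>
  also have "\<dots> = (\<Sum>i<k. real (k - i) * len_frac y i) + (\<Sum>i\<le>k. len_frac y i)"
    unfolding sum.distrib by (simp add: lessThan_Suc_atMost[symmetric])
  finally show ?thesis unfolding fill_rate_def by (simp only: distrib_left)
qed

text \<open>The indicators in \<open>assign_prob\<close> leave a single transfer rate \<zeta>/w_m,
  from column m to column m + 1. At (m, m) the two update terms, over k < m and k = m, merge into
  one sum. The guard \<open>0 < i\<close> makes the truncated \<open>j - 1\<close> harmless.\<close>

lemma drift_at_level:
  assumes "level lam \<delta> y = m" and "i \<le> j"
  shows "drift lam \<delta> y i j =
      y (i + 1) j * of_bool (i < j) - of_bool (0 < i) * y i j
      + excess lam \<delta> y / est_frac y m * (y (i - 1) m * of_bool (0 < i \<and> j = m + 1))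
      - excess lam \<delta> y / est_frac y m * (y i m * of_bool (j = m))
      + \<delta> * (if i = j \<and> j = m then \<Sum>k\<le>m. len_frac y k
             else if i = j \<and> m < j then len_frac y i else 0)
      - \<delta> * y i j"
proof -
  have "0 < i \<Longrightarrow> m = j - 1 \<longleftrightarrow> j = m + 1" using assms(2) by auto
  then show ?thesis
    unfolding drift_def Let_def assign_prob_def assms(1)
    by (auto simp: lessThan_Suc_atMost[symmetric] algebra_simps)
qed

lemma is_state_two_columns:
  assumes nonneg: "\<And>i j. i \<le> j \<Longrightarrow> 0 \<le> y i j"
    and supp: "\<And>i j. i \<le> j \<Longrightarrow> j \<noteq> m \<Longrightarrow> j \<noteq> m + 1 \<Longrightarrow> y i j = 0"
    and total: "est_frac y m + est_frac y (m + 1) = 1"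
  shows "is_state y"
proof -
  let ?A = "(\<lambda>i. (i, m)) ` {0..m}" and ?B = "(\<lambda>i. (i, m + 1)) ` {0..m + 1}"
  have "(\<Sum>(i, j)\<in>?A \<union> ?B. y i j) = (\<Sum>(i, j)\<in>?A. y i j) + (\<Sum>(i, j)\<in>?B. y i j)"
    by (rule sum.union_disjoint) auto
  also have "(\<Sum>(i, j)\<in>?A. y i j) = est_frac y m"
    unfolding est_frac_def by (subst sum.reindex) (auto simp: inj_on_def)
  also have "(\<Sum>(i, j)\<in>?B. y i j) = est_frac y (m + 1)"
    unfolding est_frac_def by (subst sum.reindex) (auto simp: inj_on_def)
  finally have "((\<lambda>(i, j). y i j) has_sum 1) (?A \<union> ?B)"
    using total has_sum_finite[of "?A \<union> ?B" "\<lambda>(i, j). y i j"] by simp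
  moreover have "((\<lambda>(i, j). y i j) has_sum 1) (?A \<union> ?B) \<longleftrightarrow>
      ((\<lambda>(i, j). y i j) has_sum 1) {(i, j). i \<le> j}"
  proof (rule has_sum_cong_neutral)
    fix x assume "x \<in> {(i, j). i \<le> j} - (?A \<union> ?B)"
    then obtain i j where "x = (i, j)" "i \<le> j" "j \<noteq> m" "j \<noteq> m + 1"
      by (cases x) (auto simp: image_iff)
    then show "(case x of (i, j) \<Rightarrow> y i j) = 0" using supp by simp
  qed auto
  ultimately show ?thesis using nonneg unfolding is_state_def by blast
qed

section \<open>Stationary equations of two neighbouring columns\<close>

text \<open>These are the drift equations in columns m and m + 1 with \<open>c\<close> in the role
  of \<zeta>/w_m; the arrival rate does not occur, so they serve both an arbitrary fixed point and
  the closed form. In \<open>low_diag\<close> the sum of v_k over k \<le> m appears as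
  \<open>1 - c * y m m\<close>, which encodes the normalisation.\<close>

locale stationary_columns =
  fixes \<delta> c :: real and m :: nat and y :: "nat \<Rightarrow> nat \<Rightarrow> real"
  assumes \<delta>_pos: "0 < \<delta>"
    and c_nonneg: "0 \<le> c"
    and nonneg: "\<And>i j. i \<le> j \<Longrightarrow> 0 \<le> y i j"
    and supp: "\<And>i j. i \<le> j \<Longrightarrow> j \<noteq> m \<Longrightarrow> j \<noteq> m + 1 \<Longrightarrow> y i j = 0"
    and low_pos: "0 < est_frac y m"
    and low_step: "\<And>i. i < m \<Longrightarrow> y (i + 1) m = (of_bool (0 < i) + \<delta> + c) * y i m"
    and low_diag: "(of_bool (0 < m) + \<delta> + c) * y m m = \<delta> * (1 - c * y m m)"
    and high_step: "\<And>i. i \<le> m \<Longrightarrow>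
      y (i + 1) (m + 1) + c * (y (i - 1) m * of_bool (0 < i)) = (of_bool (0 < i) + \<delta>) * y i (m + 1)"
    and high_diag: "y (m + 1) (m + 1) = c * y m m"
begin

lemma low_sum: "(\<delta> + c) * est_frac y m = \<delta> * (1 - c * y m m)"
proof -
  \<comment> \<open>Balance of column m across the cut below length k: service enters the lengths
    under k, and rate \<delta> + c leaves them.\<close>
  have "k \<le> m \<Longrightarrow> of_bool (0 < k) * y k m = (\<delta> + c) * (\<Sum>i<k. y i m)" for k
  proof (induction k)
    case (Suc k)
    then show ?case using low_step[of k] by (auto simp: algebra_simps)
  qed simp
  from this[of m] show ?thesis
    using low_diag unfolding est_frac_def
    by (simp add: atLeast0AtMost lessThan_Suc_atMost[symmetric] algebra_simps)
qed

text \<open>The cut above length k in column m + 1: inflow by service from length k + 1 and by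
  transfers from column m balances the updates. A transfer raises the length by one, hence
  \<open>i < k\<close> on the left.\<close>

lemma high_partial_sum:
  "k \<le> m \<Longrightarrow> y (k + 1) (m + 1) + c * (\<Sum>i<k. y i m) = \<delta> * (\<Sum>i\<le>k. y i (m + 1))"
proof (induction k)
  case 0
  then show ?case using high_step[of 0] by simp
next
  case (Suc k)
  then show ?case using high_step[of "Suc k"] by (simp add: algebra_simps)
qed

lemma high_sum: "\<delta> * est_frac y (m + 1) = c * est_frac y m + \<delta> * c * y m m"
  using high_partial_sum[of m] high_diag unfolding est_frac_def
  by (simp add: atLeast0AtMost lessThan_Suc_atMost[symmetric] algebra_simps)

text \<open>Adding the balances of the two columns cancels every term with \<open>c\<close>, so
  total mass 1 follows from the recurrences.\<close>

lemma total: "est_frac y m + est_frac y (m + 1) = 1"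
proof -
  have "\<delta> * (est_frac y m + est_frac y (m + 1)) = \<delta> * 1"
    using low_sum high_sum by (simp add: algebra_simps)
  then show ?thesis using \<delta>_pos by simp
qed

lemma is_state: "is_state y"
  using nonneg supp total by (rule is_state_two_columns)

lemma len_frac_le: "i \<le> m \<Longrightarrow> len_frac y i = y i m + y i (m + 1)"
  using len_frac_two_columns[of i m y] supp by simp

lemma len_frac_Suc: "len_frac y (m + 1) = y (m + 1) (m + 1)"
  using len_frac_two_columns[of "m + 1" m y] supp by simp

lemma len_frac_gt: "m + 1 < i \<Longrightarrow> len_frac y i = 0"
  using len_frac_two_columns[of i m y] supp by simp

lemma sum_len_frac: "(\<Sum>i\<le>m. len_frac y i) = 1 - c * y m m"
proof -
  have "(\<Sum>i\<le>m. len_frac y i) = (\<Sum>i\<le>m. y i m + y i (m + 1))"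
    by (rule sum.cong) (simp_all add: len_frac_le)
  also have "\<dots> = est_frac y m + est_frac y (m + 1) - y (m + 1) (m + 1)"
    unfolding est_frac_def by (simp add: sum.distrib atLeast0AtMost)
  finally show ?thesis using total high_diag by simp
qed

text \<open>The cut between lengths k and k + 1 over both columns: departures from length k + 1
  balance arrivals at length k and the updates of servers of length at most k, which are filled up
  to length m > k.\<close>

lemma len_frac_step:
  "k < m \<Longrightarrow> len_frac y (k + 1) - c * y k m = \<delta> * (\<Sum>i\<le>k. len_frac y i)"
proof (induction k)
  case 0
  then show ?case
    using low_step[of 0] high_step[of 0] by (simp add: len_frac_le algebra_simps)
next
  case (Suc k)
  have "len_frac y (Suc k + 1) - c * y (Suc k) m =
      len_frac y (k + 1) - c * y k m + \<delta> * len_frac y (Suc k)"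
    using low_step[of "Suc k"] high_step[of "Suc k"] Suc.prems
    by (simp add: len_frac_le algebra_simps)
  also have "len_frac y (k + 1) - c * y k m = \<delta> * (\<Sum>i\<le>k. len_frac y i)"
    using Suc by simp
  finally show ?case by (simp add: algebra_simps)
qed

text \<open>Since the increments of u are \<delta> times partial sums of v, this is
  \<open>len_frac_step\<close> summed.\<close>

lemma fill_rate_partial:
  "k \<le> m \<Longrightarrow> fill_rate \<delta> y k = (\<Sum>i\<le>k. len_frac y i) - len_frac y 0 - c * (\<Sum>i<k. y i m)"
proof (induction k)
  case 0
  then show ?case by (simp add: fill_rate_def)
next
  case (Suc k)
  then show ?case
    using len_frac_step[of k] by (simp add: fill_rate_Suc algebra_simps)
qed

text \<open>Throughput balance: fills plus remaining arrivals on the left, the fraction of busy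
  servers on the right.\<close>

lemma fill_rate_column: "fill_rate \<delta> y m + c * est_frac y m = 1 - len_frac y 0"
  using fill_rate_partial[of m] sum_len_frac unfolding est_frac_def
  by (simp add: atLeast0AtMost lessThan_Suc_atMost[symmetric] algebra_simps)

lemma min_est_column: "min_est y = m"
  unfolding min_est_def
proof (rule Least_equality)
  show "0 < est_frac y m" by (rule low_pos)
next
  fix j assume "0 < est_frac y j"
  show "m \<le> j"
  proof (rule ccontr)
    assume "\<not> m \<le> j"
    then have "est_frac y j = 0" unfolding est_frac_def by (auto intro!: sum.neutral supp)
    with \<open>0 < est_frac y j\<close> show False by simp
  qed
qed

text \<open>The assumption is the only place where the arrival rate enters. By
  \<open>fill_rate_column\<close> it says u_m + c w_m = \<open>lam\<close>; hence u_m \<le>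
  \<open>lam\<close>, the level is m, and the excess is c w_m, which returns the rate
  \<open>c\<close> assumed in the recurrences.\<close>

lemma fixed_pointI:
  assumes "len_frac y 0 = 1 - lam"
  shows "fixed_point lam \<delta> y"
proof -
  have "fill_rate \<delta> y m + c * est_frac y m = lam"
    using fill_rate_column assms by simp
  moreover have "0 \<le> c * est_frac y m" using c_nonneg low_pos by simp
  ultimately have lev: "level lam \<delta> y = m" and exc: "excess lam \<delta> y = c * est_frac y m"
    unfolding level_def excess_def min_est_column by auto
  have c: "excess lam \<delta> y / est_frac y m = c" using exc low_pos by simp
  have "drift lam \<delta> y i j = 0" if "i \<le> j" "m \<le> j" for i j
  proof -
    note drift = drift_at_level[OF lev \<open>i \<le> j\<close>, unfolded c]
    have "j = m \<or> j = m + 1 \<or> m + 1 < j" using that by linarith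
    then consider "i < m" "j = m" | "i = m" "j = m" | "i \<le> m" "j = m + 1"
      | "i = m + 1" "j = m + 1" | "m + 1 < j"
      using \<open>i \<le> j\<close> by (elim disjE) (cases "i = j"; auto)+
    then show ?thesis
    proof cases
      case 1
      then show ?thesis unfolding drift using low_step[of i] by (auto simp: algebra_simps)
    next
      case 2
      have "(of_bool (0 < m) + \<delta> + c) * y m m = \<delta> * (\<Sum>k\<le>m. len_frac y k)"
        using low_diag sum_len_frac by simp
      with 2 show ?thesis unfolding drift by (simp add: algebra_simps)
    next
      case 3
      then show ?thesis unfolding drift using high_step[of i] by (auto simp: algebra_simps)
    next
      case 4
      then show ?thesis unfolding drift using high_diag len_frac_Suc by (auto simp: algebra_simps)
    next
      case 5
      moreover from 5 have "i < j \<Longrightarrow> y (i + 1) j = 0" "y i j = 0"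
        using supp[of "i + 1" j] supp[of i j] that by auto
      moreover have "i = j \<Longrightarrow> len_frac y i = 0" using 5 len_frac_gt by simp
      ultimately show ?thesis unfolding drift by auto
    qed
  qed
  then show ?thesis unfolding fixed_point_def lev using is_state by blast
qed

end


section \<open>Marginals of a general state\<close>

lemma has_sum_len_frac:
  assumes "is_state y"
  shows "(len_frac y has_sum 1) UNIV" and "y i summable_on {i..}"
proof -
  have "{(i, j). i \<le> j} = Sigma UNIV (\<lambda>i::nat. {i..})" by auto
  with assms have sum: "((\<lambda>(i, j). y i j) has_sum 1) (Sigma UNIV (\<lambda>i. {i..}))"
    unfolding is_state_def by simp
  then have summable: "y i summable_on {i..}" for i
    using summable_on_SigmaD1[of "\<lambda>i j. y i j" UNIV "\<lambda>i. {i..}" i]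
    by (auto simp: summable_on_def)
  then show "y i summable_on {i..}" .
  show "(len_frac y has_sum 1) UNIV"
    unfolding len_frac_def using summable by (intro has_sum_SigmaD[where f = "\<lambda>(i, j). y i j", OF sum]) simp
qed

lemma len_frac_nonneg:
  assumes "is_state y"
  shows "0 \<le> len_frac y i"
  using assms unfolding len_frac_def is_state_def by (auto intro!: infsum_nonneg)

lemma len_frac_eq_0_iff:
  assumes "is_state y"
  shows "len_frac y i = 0 \<longleftrightarrow> (\<forall>j\<ge>i. y i j = 0)"
proof
  assume "len_frac y i = 0"
  then show "\<forall>j\<ge>i. y i j = 0"
    using nonneg_infsum_le_0D[of "y i" "{i..}"] has_sum_len_frac(2)[OF assms] assms
    unfolding len_frac_def is_state_def by auto
next
  assume "\<forall>j\<ge>i. y i j = 0"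
  then show "len_frac y i = 0" unfolding len_frac_def by (auto intro: infsum_0)
qed

lemma len_frac_split:
  assumes "is_state y"
  shows "len_frac y i = y i i + (\<Sum>\<^sub>\<infinity>l\<in>{Suc i..}. y i l)"
proof -
  have "{i..} = insert i {Suc i..}" by auto
  moreover have "y i summable_on {Suc i..}"
    by (rule summable_on_subset_banach[OF has_sum_len_frac(2)[OF assms]]) auto
  ultimately show ?thesis unfolding len_frac_def by (simp add: infsum_insert)
qed

lemma est_frac_nonneg:
  assumes "is_state y"
  shows "0 \<le> est_frac y j"
  using assms unfolding est_frac_def is_state_def by (auto intro!: sum_nonneg)

lemma est_frac_eq_0_iff:
  assumes "is_state y"
  shows "est_frac y j = 0 \<longleftrightarrow> (\<forall>i\<le>j. y i j = 0)"
  using assms unfolding est_frac_def is_state_def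
  by (subst sum_nonneg_eq_0_iff) auto

text \<open>Total mass 1 excludes that all columns vanish, so the \<open>LEAST\<close> in
  \<open>min_est\<close> is attained.\<close>

lemma est_frac_min_est:
  assumes "is_state y"
  shows "0 < est_frac y (min_est y)"
proof -
  have "\<exists>j. 0 < est_frac y j"
  proof (rule ccontr)
    assume "\<nexists>j. 0 < est_frac y j"
    then have "est_frac y j = 0" for j
      using est_frac_nonneg[OF assms, of j] by (simp add: not_less order_antisym)
    then have "len_frac y i = 0" for i
      using est_frac_eq_0_iff[OF assms] len_frac_eq_0_iff[OF assms] by blast
    then have "(len_frac y has_sum 0) UNIV" by (simp add: has_sum_0)
    with has_sum_len_frac(1)[OF assms] show False
      using has_sum_unique by fastforce
  qed
  then show ?thesis unfolding min_est_def by (rule LeastI_ex)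
qed

lemma column_below_min_est:
  assumes "is_state y" and "i \<le> j" and "j < min_est y"
  shows "y i j = 0"
proof -
  have "\<not> 0 < est_frac y j" using assms(3) not_less_Least unfolding min_est_def by blast
  then have "est_frac y j = 0" using est_frac_nonneg[OF assms(1), of j] by simp
  then show ?thesis using est_frac_eq_0_iff[OF assms(1)] assms(2) by blast
qed

lemma fill_rate_mono:
  assumes "is_state y" and "0 \<le> \<delta>" and "k \<le> l"
  shows "fill_rate \<delta> y k \<le> fill_rate \<delta> y l"
proof -
  have "fill_rate \<delta> y k \<le> fill_rate \<delta> y (Suc k)" for k
    using assms(2) len_frac_nonneg[OF assms(1)] by (simp add: fill_rate_Suc sum_nonneg)
  then show ?thesis using assms(3) by (rule lift_Suc_mono_le)
qed

section \<open>Structure of an arbitrary fixed point\<close>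

lemma level_fixed_point:
  assumes "fixed_point lam \<delta> y" and "0 \<le> lam" and "0 < \<delta>"
  shows "fill_rate \<delta> y (min_est y) \<le> lam" and "level lam \<delta> y = min_est y"
proof -
  have state: "is_state y" using assms(1) unfolding fixed_point_def by simp
  show le: "fill_rate \<delta> y (min_est y) \<le> lam"
  proof (rule ccontr)
    assume gt: "\<not> fill_rate \<delta> y (min_est y) \<le> lam"
    let ?K = "{k. fill_rate \<delta> y k \<le> lam}"
    define n where "n = Max ?K"
    have lev: "level lam \<delta> y = n" using gt unfolding level_def n_def by simp
    \<comment> \<open>Monotonicity of u keeps the whole set below \<open>min_est y\<close>, so
      \<open>Max\<close> is attained.\<close>
    have bound: "k < min_est y" if "k \<in> ?K" for k
      using that gt fill_rate_mono[OF state, of \<delta> "min_est y" k] assms(3)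
      by (force simp: not_le[symmetric])
    then have fin: "finite ?K" using finite_subset[of ?K "{..<min_est y}"] by blast
    have "0 \<in> ?K" using assms(2) by (simp add: fill_rate_def)
    then have n: "n \<in> ?K" unfolding n_def using fin by (intro Max_in) auto
    have "y n n = 0" using column_below_min_est[OF state _ bound[OF n]] by simp
    moreover have "drift lam \<delta> y n n = 0"
      using assms(1) lev unfolding fixed_point_def by simp
    \<comment> \<open>At (n, n) only the update terms survive: the arrival inflow is removed by
      \<open>0 < i\<close> if n = 0 and by the indicator of q otherwise, and the remaining terms
      contain \<open>y n n\<close>.\<close>
    ultimately have "\<delta> * (\<Sum>k\<le>n. len_frac y k) = 0"
      unfolding drift_def Let_def lev assign_prob_def
      by (cases n) (simp_all add: lessThan_Suc_atMost[symmetric] algebra_simps)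
    \<comment> \<open>The increment of u from n to n + 1 vanishes, which contradicts the maximality
      of n.\<close>
    then have "Suc n \<in> ?K" using n assms(3) by (simp add: fill_rate_Suc)
    then have "Suc n \<le> n" unfolding n_def using fin by (intro Max_ge)
    then show False by simp
  qed
  then show "level lam \<delta> y = min_est y" unfolding level_def by simp
qed

lemma fixed_point_tail:
  assumes fp: "fixed_point lam \<delta> y" and "0 \<le> lam" and "0 < \<delta>" and j: "min_est y + 2 \<le> j"
  shows "len_frac y j = 0"
proof -
  have state: "is_state y" using fp unfolding fixed_point_def by simp
  have lev: "level lam \<delta> y = min_est y" using level_fixed_point assms by blast
  have drift: "y (i + 1) j * of_bool (i < j) + \<delta> * len_frac y i * of_bool (i = j) =
      (of_bool (0 < i) + \<delta>) * y i j" if "i \<le> j" "min_est y + 2 \<le> j" for i j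
  proof -
    have "drift lam \<delta> y i j = 0" using fp that lev unfolding fixed_point_def by simp
    then show ?thesis
      using that unfolding drift_at_level[OF lev \<open>i \<le> j\<close>] by (auto simp: algebra_simps)
  qed
  \<comment> \<open>Off the diagonal, row j + 1 is 1 + \<delta> times row j; on the diagonal, (1 +
    \<delta>) y_(j,j) = \<delta> v_j. Summing the row, the two factors cancel.\<close>
  have const: "len_frac y (Suc j) = len_frac y j" if "min_est y + 2 \<le> j" for j
  proof -
    have "y (Suc j) l = (1 + \<delta>) * y j l" if "Suc j \<le> l" for l
      using drift[of j l] that \<open>min_est y + 2 \<le> j\<close> by simp
    then have "len_frac y (Suc j) = (\<Sum>\<^sub>\<infinity>l\<in>{Suc j..}. (1 + \<delta>) * y j l)"
      unfolding len_frac_def by (intro infsum_cong) simp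
    also have "\<dots> = (1 + \<delta>) * (len_frac y j - y j j)"
      using len_frac_split[OF state, of j] by (simp add: infsum_cmult_right')
    also have "\<dots> = len_frac y j"
      using drift[of j j] that by (simp add: algebra_simps)
    finally show ?thesis .
  qed
  have "len_frac y (k + j) = len_frac y j" for k
    using j by (induction k) (simp_all add: const)
  \<comment> \<open>The v_i are summable, so their constant tail must be zero.\<close>
  moreover have "(\<lambda>k. len_frac y (k + j)) \<longlonglongrightarrow> 0"
    using has_sum_imp_sums[OF has_sum_len_frac(1)[OF state]]
    by (intro LIMSEQ_ignore_initial_segment summable_LIMSEQ_zero) (simp add: sums_iff)
  ultimately show ?thesis by (simp add: LIMSEQ_const_iff)
qed

lemma fixed_point_supp:
  assumes fp: "fixed_point lam \<delta> y" and lam: "0 \<le> lam" and \<delta>: "0 < \<delta>"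
    and "i \<le> j" and "j \<noteq> min_est y" and "j \<noteq> min_est y + 1"
  shows "y i j = 0"
proof -
  have state: "is_state y" using fp unfolding fixed_point_def by simp
  have lev: "level lam \<delta> y = min_est y" using level_fixed_point assms by blast
  consider "j < min_est y" | "min_est y + 2 \<le> j" using assms by linarith
  then show ?thesis
  proof cases
    case 1
    then show ?thesis using column_below_min_est[OF state] \<open>i \<le> j\<close> by simp
  next
    case 2
    then have diag: "y j j = 0"
      using fixed_point_tail[OF fp lam \<delta>, of j] len_frac_eq_0_iff[OF state] by simp
    \<comment> \<open>Without arrivals, entry k + 1 of the column is a positive multiple of entry k,
      so the zero on the diagonal spreads down to length 0.\<close>
    show ?thesis using \<open>i \<le> j\<close>
    proof (induction i rule: inc_induct)
      case base
      show ?case by (rule diag)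
    next
      case (step k)
      have "drift lam \<delta> y k j = 0" using fp 2 step lev unfolding fixed_point_def by simp
      then have "y (Suc k) j = (of_bool (0 < k) + \<delta>) * y k j"
        using step 2 drift_at_level[OF lev, of k j] by (auto simp: algebra_simps)
      moreover have "of_bool (0 < k) + \<delta> \<noteq> 0" using \<delta> by (cases "0 < k") auto
      ultimately show ?case using step.IH by simp
    qed
  qed
qed

text \<open>The converse of \<open>fixed_pointI\<close>, with \<open>c\<close> read off from the
  state.\<close>

lemma fixed_point_stationary:
  assumes fp: "fixed_point lam \<delta> y" and lam: "0 \<le> lam" and \<delta>: "0 < \<delta>"
  defines "m \<equiv> min_est y"
  defines "c \<equiv> excess lam \<delta> y / est_frac y m"
  shows "stationary_columns \<delta> c m y" and "len_frac y 0 = 1 - lam"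
proof -
  have state: "is_state y" using fp unfolding fixed_point_def by simp
  have lev: "level lam \<delta> y = m" using level_fixed_point[OF fp lam \<delta>] unfolding m_def by simp
  have pos: "0 < est_frac y m" unfolding m_def by (rule est_frac_min_est[OF state])
  have supp: "y i j = 0" if "i \<le> j" "j \<noteq> m" "j \<noteq> m + 1" for i j
    using fixed_point_supp[OF fp lam \<delta>] that unfolding m_def by simp
  have exc: "excess lam \<delta> y = lam - fill_rate \<delta> y m" unfolding excess_def lev ..
  then have c: "0 \<le> c" using pos level_fixed_point(1)[OF fp lam \<delta>] unfolding c_def m_def by simp
  have drift: "y (i + 1) j * of_bool (i < j) - of_bool (0 < i) * y i j
      + c * (y (i - 1) m * of_bool (0 < i \<and> j = m + 1)) - c * (y i m * of_bool (j = m))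
      + \<delta> * (if i = j \<and> j = m then \<Sum>k\<le>m. len_frac y k
             else if i = j \<and> m < j then len_frac y i else 0)
      - \<delta> * y i j = 0" if "i \<le> j" "m \<le> j" for i j
    using fp that lev drift_at_level[OF lev \<open>i \<le> j\<close>] unfolding fixed_point_def c_def by simp
  have v1: "len_frac y (m + 1) = y (m + 1) (m + 1)"
    using len_frac_two_columns[of "m + 1" m y] supp by simp
  \<comment> \<open>Here v_(m+1) = y_(m+1,m+1), so the two update terms cancel.\<close>
  have high_diag: "y (m + 1) (m + 1) = c * y m m"
    using drift[of "m + 1" "m + 1"] v1 by (simp add: algebra_simps)
  have "(len_frac y has_sum (\<Sum>i\<le>m + 1. len_frac y i)) UNIV"
  proof -
    have "len_frac y i = 0" if "m + 1 < i" for i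
      using len_frac_two_columns[of i m y] supp that by simp
    then have "(len_frac y has_sum (\<Sum>i\<le>m + 1. len_frac y i)) {..m + 1} \<longleftrightarrow>
      (len_frac y has_sum (\<Sum>i\<le>m + 1. len_frac y i)) UNIV"
      by (intro has_sum_cong_neutral) auto
    then show ?thesis by (simp add: has_sum_finite del: sum.atMost_Suc)
  qed
  then have "(\<Sum>i\<le>m + 1. len_frac y i) = 1"
    using has_sum_len_frac(1)[OF state] has_sum_unique by blast
  \<comment> \<open>This turns the update inflow at (m, m) into the form required by
    \<open>low_diag\<close>.\<close>
  then have sum: "(\<Sum>i\<le>m. len_frac y i) = 1 - c * y m m"
    using v1 high_diag by simp
  show stat: "stationary_columns \<delta> c m y"
  proof
    show "0 \<le> y i j" if "i \<le> j" for i j using state that unfolding is_state_def by simp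
    show "y i j = 0" if "i \<le> j" "j \<noteq> m" "j \<noteq> m + 1" for i j using supp that .
    show "y (i + 1) m = (of_bool (0 < i) + \<delta> + c) * y i m" if "i < m" for i
      using drift[of i m] that by (auto simp: algebra_simps)
    have "(of_bool (0 < m) + \<delta> + c) * y m m = \<delta> * (\<Sum>i\<le>m. len_frac y i)"
      using drift[of m m] by (cases "m = 0") (auto simp: algebra_simps)
    then show "(of_bool (0 < m) + \<delta> + c) * y m m = \<delta> * (1 - c * y m m)"
      unfolding sum .
    show "y (i + 1) (m + 1) + c * (y (i - 1) m * of_bool (0 < i)) =
        (of_bool (0 < i) + \<delta>) * y i (m + 1)" if "i \<le> m" for i
      using drift[of i "m + 1"] that by (auto simp: algebra_simps)
  qed (use \<delta> c pos high_diag in auto)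
  have "c * est_frac y m = lam - fill_rate \<delta> y m" using pos exc unfolding c_def by simp
  then show "len_frac y 0 = 1 - lam"
    using stationary_columns.fill_rate_column[OF stat] by simp
qed

text \<open>For fixed \<open>c\<close> everything is solved from the diagonal downwards:
  \<open>low_diag\<close> fixes the entry (m, m), \<open>low_step\<close> the rest of column m, then
  \<open>high_diag\<close> and \<open>high_step\<close> column m + 1. All coefficients divided by
  are positive.\<close>

lemma stationary_columns_unique:
  assumes "stationary_columns \<delta> c m y" and "stationary_columns \<delta> c m z" and "i \<le> j"
  shows "y i j = z i j"
proof -
  interpret y: stationary_columns \<delta> c m y by fact
  interpret z: stationary_columns \<delta> c m z by fact
  have coeff: "0 < of_bool P + \<delta>" "0 < of_bool P + \<delta> + c" for P
    using y.\<delta>_pos y.c_nonneg by (cases P; simp)+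
  have low: "y i m = z i m" if "i \<le> m" for i
    using that
  proof (induction i rule: inc_induct)
    case base
    have "(of_bool (0 < m) + \<delta> + c + \<delta> * c) * y m m = (of_bool (0 < m) + \<delta> + c + \<delta> * c) * z m m"
      using y.low_diag z.low_diag by (simp add: algebra_simps)
    moreover have "0 < of_bool (0 < m) + \<delta> + c + \<delta> * c"
      by (rule add_pos_nonneg[OF coeff(2)]) (use y.\<delta>_pos y.c_nonneg in simp)
    ultimately show ?case by simp
  next
    case (step k)
    then show ?case using y.low_step[of k] z.low_step[of k] coeff(2)[of "0 < k"] by simp
  qed
  have "y i (m + 1) = z i (m + 1)" if "i \<le> m + 1" for i
    using that
  proof (induction i rule: inc_induct)
    case base
    show ?case using y.high_diag z.high_diag low by simp
  next
    case (step k)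
    then have "(of_bool (0 < k) + \<delta>) * y k (m + 1) =
        y (k + 1) (m + 1) + c * (y (k - 1) m * of_bool (0 < k))"
      using y.high_step[of k] by simp
    also have "\<dots> = z (k + 1) (m + 1) + c * (z (k - 1) m * of_bool (0 < k))"
      using step low[of "k - 1"] by simp
    also have "\<dots> = (of_bool (0 < k) + \<delta>) * z k (m + 1)"
      using z.high_step[of k] step by simp
    finally show ?case using coeff(1)[of "0 < k"] by (metis less_irrefl mult_cancel_left)
  qed
  with low show ?thesis using assms(3) y.supp z.supp by metis
qed

section \<open>The closed form\<close>

context
  fixes \<delta> \<nu> :: real
  assumes \<delta>_pos: "0 < \<delta>" and \<nu>_nonneg: "0 \<le> \<nu>"
begin

text \<open>Trades the exponent -1 that occurs for m = 0 for a natural power, uniformly in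
  m.\<close>

lemma powi_pred: "(1 / (1 + \<delta> + \<nu>)) powi (int m - 1) = (1 / (1 + \<delta> + \<nu>)) ^ m * (1 + \<delta> + \<nu>)"
proof -
  have "(1 / (1 + \<delta> + \<nu>)) powi (int m - 1) = (1 / (1 + \<delta> + \<nu>)) powi int m / (1 / (1 + \<delta> + \<nu>))"
    using \<delta>_pos \<nu>_nonneg by (subst power_int_diff) auto
  then show ?thesis by simp
qed

text \<open>In this factorisation each factor depending on \<nu> is positive and nonincreasing,
  which makes monotonicity and bounds visible.\<close>

lemma hfun_eq:
  "hfun \<delta> m \<nu> = (1 / (1 + \<delta>)) ^ (m + 1)
    + (\<delta> / (1 + \<delta>))\<^sup>2 * ((1 / (1 + \<delta> + \<nu>)) ^ m * ((1 + 1 / (\<delta> + \<nu>)) * (1 / (1 + \<nu>))))"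
proof -
  have "(1 + 1 / (\<delta> + \<nu>)) * (1 / (1 + \<nu>)) = (1 + \<delta> + \<nu>) / ((1 + \<nu>) * (\<delta> + \<nu>))"
    using \<delta>_pos \<nu>_nonneg by (simp add: divide_simps)
  then show ?thesis
    unfolding hfun_def Let_def powi_pred by (simp add: power_divide mult_ac)
qed

lemma hfun_gt: "(1 / (1 + \<delta>)) ^ (m + 1) < hfun \<delta> m \<nu>"
proof -
  have "0 < 1 + 1 / (\<delta> + \<nu>)" using \<delta>_pos \<nu>_nonneg by (intro add_pos_nonneg) auto
  then show ?thesis unfolding hfun_eq using \<delta>_pos \<nu>_nonneg by simp
qed

lemma ystar_idle: "ystar \<delta> m \<nu> 0 m + ystar \<delta> m \<nu> 0 (m + 1) = hfun \<delta> m \<nu>"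
proof -
  define a E where "a = 1 / (1 + \<delta>)"
    and "E = (1 / (1 + \<delta> + \<nu>)) powi (int m - 1) * \<delta> / ((1 + \<nu>) * (\<delta> + \<nu>))"
  \<comment> \<open>The two columns contribute \<open>a * E\<close> and
    \<open>- a\<^sup>2 * E\<close>; this identity merges them into the second term of h.\<close>
  have "a - a\<^sup>2 = a\<^sup>2 * \<delta>" using \<delta>_pos by (simp add: a_def divide_simps power2_eq_square)
  then have "a * E - a\<^sup>2 * E = a\<^sup>2 * \<delta> * E" by (simp flip: left_diff_distrib)
  then show ?thesis
    unfolding ystar_def hfun_def Let_def a_def[symmetric]
    by (simp add: E_def power2_eq_square mult_ac)
qed

lemma ystar_nonneg: "0 \<le> ystar \<delta> m \<nu> i j"
proof -
  define a b where "a = 1 / (1 + \<delta>)" and "b = 1 / (1 + \<delta> + \<nu>)"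
  have ab: "0 < b" "b \<le> a" "0 < a" using \<delta>_pos \<nu>_nonneg by (auto simp: a_def b_def frac_le)
  have pow: "b ^ k \<le> a ^ k" for k using ab by (intro power_mono) auto
  \<comment> \<open>The cleared form of y_(0,m) \<le> 1 at m = 0, with equality at \<nu> = 0;
    together with b \<le> a it bounds the subtracted term in y_(0,m+1).\<close>
  have "\<delta> * (1 + \<delta> + \<nu>) \<le> (1 + \<delta>) * ((1 + \<nu>) * (\<delta> + \<nu>))"
  proof -
    have "(1 + \<delta>) * ((1 + \<nu>) * (\<delta> + \<nu>)) - \<delta> * (1 + \<delta> + \<nu>)
        = \<nu> * (1 + \<delta> + \<delta> * \<delta>) + (1 + \<delta>) * (\<nu> * \<nu>)" by (simp add: algebra_simps)
    also have "\<dots> \<ge> 0" using \<delta>_pos \<nu>_nonneg by simp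
    finally show ?thesis by simp
  qed
  then have "a * ((1 + \<delta> + \<nu>) * \<delta> / ((1 + \<nu>) * (\<delta> + \<nu>))) \<le> 1"
    using \<delta>_pos \<nu>_nonneg by (simp add: a_def divide_le_eq mult_ac)
  then have "a * b ^ m * (a * ((1 + \<delta> + \<nu>) * \<delta> / ((1 + \<nu>) * (\<delta> + \<nu>)))) \<le> a * b ^ m"
    using ab by (intro mult_left_le) auto
  also have "\<dots> \<le> a ^ (m + 1)" using pow[of m] ab by simp
  finally have head: "a\<^sup>2 * (b ^ m * (1 + \<delta> + \<nu>)) * \<delta> / ((1 + \<nu>) * (\<delta> + \<nu>)) \<le> a ^ (m + 1)"
    by (simp add: power2_eq_square mult_ac)
  have high: "a * b ^ (m + 1 - i) / (1 + \<nu>) \<le> a ^ (m + 2 - i)" if "i \<le> m + 1"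
  proof -
    have "a * b ^ (m + 1 - i) / (1 + \<nu>) \<le> a * b ^ (m + 1 - i)"
      using ab \<nu>_nonneg divide_left_mono[of 1 "1 + \<nu>" "a * b ^ (m + 1 - i)"] by simp
    also have "\<dots> \<le> a * a ^ (m + 1 - i)" using ab pow by simp
    also have "\<dots> = a ^ (m + 2 - i)" using that by (simp add: Suc_diff_le flip: power_Suc)
    finally show ?thesis .
  qed
  show ?thesis
    unfolding ystar_def Let_def powi_pred unfolding a_def[symmetric] b_def[symmetric]
    using head high ab \<delta>_pos \<nu>_nonneg by auto
qed

lemma ystar_supp: "j \<noteq> m \<Longrightarrow> j \<noteq> m + 1 \<Longrightarrow> ystar \<delta> m \<nu> i j = 0"
  by (simp add: ystar_def Let_def)

lemma ystar_low_pos: "0 < ystar \<delta> m \<nu> 0 m"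
  using \<delta>_pos \<nu>_nonneg unfolding ystar_def Let_def powi_pred by simp

lemma ystar_est_frac_pos: "0 < est_frac (ystar \<delta> m \<nu>) m"
  unfolding est_frac_def using ystar_low_pos ystar_nonneg by (intro sum_pos2[of _ 0]) auto

lemma stationary_ystar:
  assumes "0 < m"
  shows "stationary_columns \<delta> \<nu> m (ystar \<delta> m \<nu>)"
proof -
  \<comment> \<open>\<open>E\<close> is the entry (0, m); entry (1, m) is (\<delta> + \<nu>) E, as
    the step from length 0, where nobody is served, demands.\<close>
  define a b E where "a = 1 / (1 + \<delta>)" and "b = 1 / (1 + \<delta> + \<nu>)"
    and "E = a * b ^ (m - 1) * \<delta> / ((1 + \<nu>) * (\<delta> + \<nu>))"
  define z where "z = ystar \<delta> m \<nu>"
  have a: "(1 + \<delta>) * a = 1" and b: "(1 + \<delta> + \<nu>) * b = 1"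
    using \<delta>_pos \<nu>_nonneg by (auto simp: a_def b_def)
  have E: "a * b ^ (m - 1) * \<delta> / (1 + \<nu>) = (\<delta> + \<nu>) * E"
    using \<delta>_pos \<nu>_nonneg by (simp add: E_def)
  have pred: "b powi (int m - 1) = b ^ (m - 1)"
    using assms by (simp add: of_nat_diff flip: power_int_of_nat)
  have low0: "z 0 m = E" and high0: "z 0 (m + 1) = a ^ (m + 1) - a * E"
    and high1: "z 1 (m + 1) = \<delta> * (a ^ (m + 1) - a * E)"
    by (simp_all add: z_def ystar_def Let_def E_def pred power2_eq_square
          flip: a_def b_def)
  have low: "z i m = a * b ^ (m - i) * \<delta> / (1 + \<nu>)" if "0 < i" "i \<le> m" for i
    using that by (simp add: z_def ystar_def Let_def flip: a_def b_def)
  have high: "z i (m + 1) = \<delta> * (a ^ (m + 2 - i) - a * b ^ (m + 1 - i) / (1 + \<nu>))"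
    if "1 < i" "i \<le> m + 1" for i
    using that by (simp add: z_def ystar_def Let_def flip: a_def b_def)
  have "stationary_columns \<delta> \<nu> m z"
  proof
    show "z (i + 1) m = (of_bool (0 < i) + \<delta> + \<nu>) * z i m" if "i < m" for i
    proof (cases "i = 0")
      case True
      then show ?thesis using assms low[of 1] low0 E by simp
    next
      case False
      have "b ^ (m - (i + 1)) = (1 + \<delta> + \<nu>) * b * b ^ (m - (i + 1))" using b by simp
      also have "\<dots> = (1 + \<delta> + \<nu>) * b ^ (m - i)"
        using that by (simp add: Suc_diff_Suc flip: power_Suc)
      finally show ?thesis using False that by (simp add: low)
    qed
    have "z m m * (1 + \<nu>) * (1 + \<delta>) = (1 + \<delta>) * a * \<delta>" using low[of m] assms \<nu>_nonneg by simp
    also have "\<dots> = \<delta>" unfolding a by simp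
    finally have "z m m * (1 + \<nu>) * (1 + \<delta>) = \<delta>" .
    then show "(of_bool (0 < m) + \<delta> + \<nu>) * z m m = \<delta> * (1 - \<nu> * z m m)"
      using assms by (simp add: algebra_simps)
    show "z (i + 1) (m + 1) + \<nu> * (z (i - 1) m * of_bool (0 < i)) =
        (of_bool (0 < i) + \<delta>) * z i (m + 1)" if "i \<le> m" for i
    proof -
      \<comment> \<open>Row 1 is separate because its transfers come from the exceptional entry (0,
        m).\<close>
      consider "i = 0" | "i = 1" | "1 < i" by linarith
      then show ?thesis
      proof cases
        case 1
        then show ?thesis using high0 high1 by simp
      next
        case 2
        have "z 2 (m + 1) = \<delta> * a ^ m - (\<delta> + \<nu>) * E"
          using high[of 2] assms E by (simp add: algebra_simps)
        then have "z 2 (m + 1) + \<nu> * z 0 m = (1 + \<delta>) * a * (\<delta> * a ^ m - \<delta> * E)"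
          unfolding a low0 by (simp add: algebra_simps)
        also have "\<dots> = (1 + \<delta>) * z 1 (m + 1)" unfolding high1 by (simp add: algebra_simps)
        finally show ?thesis using 2 by (simp add: numeral_2_eq_2)
      next
        case 3
        \<comment> \<open>\<open>A\<close> and \<open>G\<close> are the two parts of entry (i + 1, m
          + 1); lowering i by one multiplies them by a and b.\<close>
        define A G where "A = a ^ (m + 1 - i)" and "G = a * b ^ (m - i) / (1 + \<nu>)"
        have *: "m + 2 - i = Suc (m + 1 - i)" "m + 1 - i = Suc (m - i)" "m - (i - 1) = Suc (m - i)"
          using that 3 by auto
        have up: "z (i + 1) (m + 1) = \<delta> * (A - G)"
          using high[of "i + 1"] that 3 by (simp add: A_def G_def)
        have left: "z (i - 1) m = \<delta> * (b * G)"
          using low[of "i - 1"] that 3 unfolding *(3) by (simp add: G_def)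
        have here: "z i (m + 1) = \<delta> * (a * A - b * G)"
          using high[of i] that 3 unfolding A_def *(1,2) by (simp add: G_def)
        have "(1 + \<delta>) * (\<delta> * (a * A - b * G)) =
            \<delta> * ((1 + \<delta>) * a * A - (1 + \<delta> + \<nu>) * b * G + \<nu> * (b * G))"
          by (simp add: algebra_simps)
        also have "\<dots> = \<delta> * (A - G) + \<nu> * (\<delta> * (b * G))" unfolding a b by (simp add: algebra_simps)
        finally show ?thesis using 3 up left here by simp
      qed
    qed
    have "a - a / (1 + \<nu>) = \<nu> * (a / (1 + \<nu>))"
      using \<nu>_nonneg by (simp add: field_simps)
    then show "z (m + 1) (m + 1) = \<nu> * z m m"
      using high[of "m + 1"] low[of m] assms by simp
  qed (use \<delta>_pos \<nu>_nonneg ystar_nonneg ystar_supp ystar_est_frac_pos z_def in auto)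
  then show ?thesis unfolding z_def .
qed

text \<open>The rate is forced by \<open>high_diag\<close>. The rest reduces to z_(1,1) = \<delta>
  z_(0,1) and z_(0,1) = a (1 - z_(0,0)), which together give total mass 1.\<close>

lemma stationary_ystar_0:
  fixes z
  defines "z \<equiv> ystar \<delta> 0 \<nu>"
  shows "stationary_columns \<delta> (z 1 1 / z 0 0) 0 z"
proof -
  have pos: "0 < z 0 0" unfolding z_def by (rule ystar_low_pos)
  have high: "z 1 1 = \<delta> * z 0 1" by (simp add: z_def ystar_def Let_def)
  define a where "a = 1 / (1 + \<delta>)"
  have a: "(1 + \<delta>) * a = 1" using \<delta>_pos by (simp add: a_def)
  have "z 0 1 = a * (1 - z 0 0)"
    unfolding z_def ystar_def Let_def a_def[symmetric]
    by (simp add: power2_eq_square right_diff_distrib)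
  then have "(1 + \<delta>) * z 0 1 = (1 + \<delta>) * a * (1 - z 0 0)" by (simp only: mult.assoc)
  then have total: "z 0 1 = 1 - z 0 0 - \<delta> * z 0 1" unfolding a by (simp add: algebra_simps)
  show ?thesis
  proof
    have "z 1 1 = \<delta> * (1 - z 0 0 - z 1 1)" unfolding high by (subst total) simp
    then show "(of_bool (0 < (0::nat)) + \<delta> + z 1 1 / z 0 0) * z 0 0 =
        \<delta> * (1 - z 1 1 / z 0 0 * z 0 0)"
      using pos by (simp add: algebra_simps)
    show "z (i + 1) (0 + 1) + z 1 1 / z 0 0 * (z (i - 1) 0 * of_bool (0 < i)) =
        (of_bool (0 < i) + \<delta>) * z i (0 + 1)" if "i \<le> 0" for i
      using that high by simp
  qed (use \<delta>_pos pos ystar_nonneg ystar_supp[of _ 0] ystar_est_frac_pos[of 0] z_def in auto)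
qed

lemma fixed_point_ystar:
  assumes "hfun \<delta> m \<nu> = 1 - lam"
  shows "fixed_point lam \<delta> (ystar \<delta> m \<nu>)"
proof -
  obtain c where "stationary_columns \<delta> c m (ystar \<delta> m \<nu>)"
    using stationary_ystar stationary_ystar_0 by (cases "m = 0") auto
  then interpret stationary_columns \<delta> c m "ystar \<delta> m \<nu>" .
  show ?thesis using fixed_pointI len_frac_le[of 0] ystar_idle assms by simp
qed

end

section \<open>Monotonicity and range of h\<close>

text \<open>The power of b is constant for m = 0, so strictness is drawn from the factor 1/(1 +
  \<nu>).\<close>

lemma hfun_strict_antimono:
  assumes "0 < \<delta>" and "0 \<le> \<nu>" and "\<nu> < \<nu>'"
  shows "hfun \<delta> m \<nu>' < hfun \<delta> m \<nu>"
proof -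
  have "(1 / (1 + \<delta> + \<nu>')) ^ m \<le> (1 / (1 + \<delta> + \<nu>)) ^ m"
    using assms by (intro power_mono frac_le) auto
  moreover have "(1 + 1 / (\<delta> + \<nu>')) * (1 / (1 + \<nu>')) < (1 + 1 / (\<delta> + \<nu>)) * (1 / (1 + \<nu>))"
  proof (rule mult_le_less_imp_less)
    show "1 + 1 / (\<delta> + \<nu>') \<le> 1 + 1 / (\<delta> + \<nu>)" using assms by (simp add: frac_le)
    show "1 / (1 + \<nu>') < 1 / (1 + \<nu>)" using assms by (simp add: frac_less2)
    show "0 < 1 + 1 / (\<delta> + \<nu>')" using assms by (simp add: add_pos_pos)
  qed (use assms in simp)
  ultimately have "(1 / (1 + \<delta> + \<nu>')) ^ m * ((1 + 1 / (\<delta> + \<nu>')) * (1 / (1 + \<nu>'))) <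
      (1 / (1 + \<delta> + \<nu>)) ^ m * ((1 + 1 / (\<delta> + \<nu>)) * (1 / (1 + \<nu>)))"
    by (rule mult_le_less_imp_less) (use assms in \<open>simp_all add: add_nonneg_nonneg\<close>)
  from mult_strict_left_mono[OF this, of "(\<delta> / (1 + \<delta>))\<^sup>2"]
  show ?thesis using assms by (simp only: hfun_eq) simp
qed

lemma hfun_inj:
  assumes "0 < \<delta>" and "0 \<le> \<nu>" and "0 \<le> \<nu>'" and "hfun \<delta> m \<nu> = hfun \<delta> m \<nu>'"
  shows "\<nu> = \<nu>'"
  using hfun_strict_antimono[OF assms(1,2), of \<nu>' m] hfun_strict_antimono[OF assms(1,3), of \<nu> m] assms(4)
  by (cases \<nu> \<nu>' rule: linorder_cases) auto

lemma hfun_0: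
  assumes "0 < \<delta>"
  shows "hfun \<delta> m 0 = (1 / (1 + \<delta>)) ^ m"
proof -
  have "1 / (1 + \<delta>) + (\<delta> / (1 + \<delta>))\<^sup>2 * (1 + 1 / \<delta>) = 1"
    using assms by (simp add: divide_simps power2_eq_square) (simp add: algebra_simps)
  then have "(1 / (1 + \<delta>)) ^ m =
      (1 / (1 + \<delta>)) ^ m * (1 / (1 + \<delta>) + (\<delta> / (1 + \<delta>))\<^sup>2 * (1 + 1 / \<delta>))" by simp
  also have "\<dots> = hfun \<delta> m 0" using assms by (simp add: hfun_eq distrib_left mult_ac)
  finally show ?thesis by simp
qed

lemma hfun_le:
  assumes "0 < \<delta>" and "0 \<le> \<nu>"
  shows "hfun \<delta> m \<nu> \<le> (1 / (1 + \<delta>)) ^ m"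
  using hfun_strict_antimono[of \<delta> 0 \<nu> m] hfun_0[of \<delta> m] assms by (cases "\<nu> = 0") auto

lemma hfun_surj:
  assumes \<delta>: "0 < \<delta>" and lower: "(1 / (1 + \<delta>)) ^ (m + 1) < x" and upper: "x \<le> (1 / (1 + \<delta>)) ^ m"
  shows "\<exists>\<nu>\<ge>0. hfun \<delta> m \<nu> = x"
proof -
  define C where "C = (\<delta> / (1 + \<delta>))\<^sup>2 * (1 + 1 / \<delta>)"
  \<comment> \<open>For \<nu> > 0 the difference h(\<nu>) - a^(m+1) is at most C/\<nu>;
    \<open>N\<close> makes this bound equal to x - a^(m+1), so that h(N) \<le> x \<le> h(0).\<close>
  define N where "N = C / (x - (1 / (1 + \<delta>)) ^ (m + 1))"
  have C: "0 < C" using \<delta> by (simp add: C_def add_pos_pos)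
  then have N: "0 < N" using lower by (simp add: N_def)
  have "(1 / (1 + \<delta> + N)) ^ m * ((1 + 1 / (\<delta> + N)) * (1 / (1 + N))) \<le>
      1 * ((1 + 1 / \<delta>) * (1 / N))"
    using N \<delta> by (intro mult_mono power_le_one add_left_mono frac_le) auto
  from mult_left_mono[OF this, of "(\<delta> / (1 + \<delta>))\<^sup>2"]
  have "hfun \<delta> m N \<le> (1 / (1 + \<delta>)) ^ (m + 1) + C / N"
    using \<delta> N by (simp only: hfun_eq C_def) simp
  also have "\<dots> = x" using C N lower by (simp add: N_def)
  finally have "hfun \<delta> m N \<le> x" .
  moreover have "continuous_on {0..N} (hfun \<delta> m)"
  proof -
    have "continuous_on {0..N} (\<lambda>\<nu>. (1 / (1 + \<delta>)) ^ (m + 1)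
      + (\<delta> / (1 + \<delta>))\<^sup>2 * ((1 / (1 + \<delta> + \<nu>)) ^ m * ((1 + 1 / (\<delta> + \<nu>)) * (1 / (1 + \<nu>)))))"
      using \<delta> by (intro continuous_intros) auto
    then show ?thesis
      by (rule continuous_on_eq) (use \<delta> in \<open>simp add: hfun_eq\<close>)
  qed
  ultimately show ?thesis
    using IVT2'[of "hfun \<delta> m" N x 0] upper hfun_0[OF \<delta>, of m] N by auto
qed

section \<open>Locating the level\<close>

text \<open>The bracket for 1 - \<lambda> is exactly the range of h on \<nu> \<ge> 0. Powers of a
  tend to 0, so the \<open>LEAST\<close> exists; its minimality gives the upper bound, which is
  trivial at level 0.\<close>

lemma mstar_bounds:
  assumes "0 < \<delta>" and "0 \<le> lam" and "lam < 1"
  shows "(1 / (1 + \<delta>)) ^ (mstar lam \<delta> + 1) < 1 - lam" and "1 - lam \<le> (1 / (1 + \<delta>)) ^ mstar lam \<delta>"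
proof -
  let ?P = "\<lambda>m. lam < 1 - (1 / (1 + \<delta>)) ^ (m + 1)"
  obtain n where "(1 / (1 + \<delta>)) ^ n < 1 - lam"
    using real_arch_pow_inv[of "1 - lam" "1 / (1 + \<delta>)"] assms by auto
  moreover have "(1 / (1 + \<delta>)) ^ (n + 1) \<le> (1 / (1 + \<delta>)) ^ n"
    using assms by (intro power_decreasing) auto
  ultimately have "?P n" by simp
  then have "?P (mstar lam \<delta>)" unfolding mstar_def by (rule LeastI)
  then show "(1 / (1 + \<delta>)) ^ (mstar lam \<delta> + 1) < 1 - lam" by simp
  show "1 - lam \<le> (1 / (1 + \<delta>)) ^ mstar lam \<delta>"
  proof (cases "mstar lam \<delta>")
    case (Suc k)
    then have "\<not> ?P k" unfolding mstar_def using not_less_Least[of k ?P] by simp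
    then show ?thesis using Suc by simp
  qed (use assms in simp)
qed

lemma mstar_unique:
  assumes \<delta>: "0 < \<delta>" and "0 \<le> lam" and "lam < 1"
    and "(1 / (1 + \<delta>)) ^ (m + 1) < 1 - lam" and "1 - lam \<le> (1 / (1 + \<delta>)) ^ m"
  shows "mstar lam \<delta> = m"
proof -
  have less: "k < l + 1" if "(1 / (1 + \<delta>)) ^ (l + 1) < (1 / (1 + \<delta>)) ^ k" for k l
    using that \<delta> power_strict_decreasing_iff[of "1 / (1 + \<delta>)" "l + 1" k] by simp
  show ?thesis
    using less[of m "mstar lam \<delta>"] less[of "mstar lam \<delta>" m] mstar_bounds[OF assms(1-3)] assms(4,5)
    by simp
qed

text \<open>For m = 0, v_0 = 1 - c y_(0,0) means \<lambda> = c y_(0,0); eliminating y_(0,0) by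
  \<open>low_diag\<close> leaves a linear equation for \<open>c\<close>.\<close>

lemma stationary_parameter_0:
  assumes "stationary_columns \<delta> c 0 y" and "len_frac y 0 = 1 - lam"
  shows "c * (\<delta> - lam * (1 + \<delta>)) = lam * \<delta>"
proof -
  interpret stationary_columns \<delta> c 0 y by fact
  have lam: "lam = c * y 0 0" using sum_len_frac assms(2) by simp
  have "(\<delta> + c + \<delta> * c) * y 0 0 = \<delta>" using low_diag by (simp add: algebra_simps)
  then have "(\<delta> + c + \<delta> * c) * lam = c * \<delta>" unfolding lam by (simp add: mult.left_commute)
  then show ?thesis by (simp add: algebra_simps)
qed

text \<open>A fixed point brings its own level and rate; these must be matched with
  \<open>mstar\<close> and \<nu> before the uniqueness of the recurrences applies.\<close>

lemma fixed_point_eq_ystar: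
  assumes lam: "0 < lam" "lam < 1" and \<delta>: "0 < \<delta>"
    and \<nu>: "0 \<le> \<nu>" "hfun \<delta> (mstar lam \<delta>) \<nu> = 1 - lam"
    and fp: "fixed_point lam \<delta> y" and "i \<le> j"
  shows "y i j = ystar \<delta> (mstar lam \<delta>) \<nu> i j"
proof -
  define m c where "m = min_est y" and "c = excess lam \<delta> y / est_frac y m"
  have y: "stationary_columns \<delta> c m y" "len_frac y 0 = 1 - lam"
    using fixed_point_stationary[OF fp _ \<delta>] lam unfolding m_def c_def by auto
  interpret y: stationary_columns \<delta> c m y by fact
  show ?thesis
  proof (cases "m = 0")
    case True
    let ?z = "ystar \<delta> 0 \<nu>" let ?d = "?z 1 1 / ?z 0 0"
    have c: "c * (\<delta> - lam * (1 + \<delta>)) = lam * \<delta>"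
      using stationary_parameter_0 y unfolding True by blast
    \<comment> \<open>The right side is positive and \<open>c\<close> is nonnegative, so the
      coefficient is positive. This says a < 1 - \<lambda>, the bracket of level 0.\<close>
    then have pos: "0 < \<delta> - lam * (1 + \<delta>)"
      using y.c_nonneg lam \<delta> by (metis mult_pos_pos zero_less_mult_pos order_le_less mult_zero_left less_irrefl)
    then have m: "mstar lam \<delta> = 0"
      using lam \<delta> by (intro mstar_unique) (auto simp: field_simps)
    have z: "stationary_columns \<delta> ?d 0 ?z" using stationary_ystar_0 \<delta> \<nu> by simp
    interpret z: stationary_columns \<delta> ?d 0 ?z by fact
    have "len_frac ?z 0 = 1 - lam"
      using z.len_frac_le[of 0] ystar_idle[OF \<delta> \<nu>(1), of 0] \<nu>(2) m by simp
    then have "?d * (\<delta> - lam * (1 + \<delta>)) = lam * \<delta>" using stationary_parameter_0 z by blast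
    with c pos have "c = ?d" by (metis less_irrefl mult_cancel_right)
    then show ?thesis using stationary_columns_unique[OF _ z \<open>i \<le> j\<close>] y(1) m True by simp
  next
    case False
    \<comment> \<open>The closed form is taken at the state's own level and rate; the bounds on h(c)
      then force m = m*, and injectivity of h gives c = \<nu>.\<close>
    then have z: "stationary_columns \<delta> c m (ystar \<delta> m c)"
      using stationary_ystar \<delta> y.c_nonneg by simp
    then have eq: "y i j = ystar \<delta> m c i j" if "i \<le> j" for i j
      using stationary_columns_unique y(1) that by blast
    then have h: "hfun \<delta> m c = 1 - lam"
      using y.len_frac_le[of 0] y(2) ystar_idle[OF \<delta> y.c_nonneg, of m] by simp
    then have m: "mstar lam \<delta> = m"
      using hfun_gt[OF \<delta> y.c_nonneg, of m] hfun_le[OF \<delta> y.c_nonneg, of m] lam \<delta>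
      by (intro mstar_unique) auto
    then have "c = \<nu>" using hfun_inj[OF \<delta> y.c_nonneg \<nu>(1), of m] \<nu>(2) h by simp
    then show ?thesis using eq \<open>i \<le> j\<close> m by simp
  qed
qed

section \<open>Other formulas for the level, and the critical arrival rates\<close>

text \<open>The set is the initial segment up to \<open>mstar lam \<delta>\<close>, so
  \<open>Max\<close> is taken over a finite set.\<close>

lemma mstar_eq_Max:
  assumes "0 < \<delta>" and "0 \<le> lam" and "lam < 1"
  shows "mstar lam \<delta> = Max {k. 1 - (1 / (1 + \<delta>)) ^ k \<le> lam}"
proof -
  note bounds = mstar_bounds[OF assms]
  have "1 - (1 / (1 + \<delta>)) ^ k \<le> lam \<longleftrightarrow> k \<le> mstar lam \<delta>" for k
  proof
    assume "k \<le> mstar lam \<delta>"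
    then have "(1 / (1 + \<delta>)) ^ mstar lam \<delta> \<le> (1 / (1 + \<delta>)) ^ k"
      using assms by (intro power_decreasing) auto
    then show "1 - (1 / (1 + \<delta>)) ^ k \<le> lam" using bounds by simp
  next
    assume le: "1 - (1 / (1 + \<delta>)) ^ k \<le> lam"
    show "k \<le> mstar lam \<delta>"
    proof (rule ccontr)
      assume "\<not> k \<le> mstar lam \<delta>"
      then have "(1 / (1 + \<delta>)) ^ k \<le> (1 / (1 + \<delta>)) ^ (mstar lam \<delta> + 1)"
        using assms by (intro power_decreasing) auto
      then show False using bounds le by simp
    qed
  qed
  then have "{k. 1 - (1 / (1 + \<delta>)) ^ k \<le> lam} = {..mstar lam \<delta>}" by auto
  then show ?thesis using Max_eq_iff[of "{..mstar lam \<delta>}" "mstar lam \<delta>"] by simp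
qed

lemma ln_inverse_power:
  assumes "0 < (\<delta>::real)"
  shows "ln ((1 / (1 + \<delta>)) ^ k) = - (real k * ln (1 + \<delta>))"
  using assms by (simp add: ln_realpow ln_div)

lemma mstar_eq_floor:
  assumes "0 < \<delta>" and "0 \<le> lam" and "lam < 1"
  shows "int (mstar lam \<delta>) = \<lfloor>- (ln (1 - lam) / ln (1 + \<delta>))\<rfloor>"
proof -
  note bounds = mstar_bounds[OF assms]
  have pos: "0 < ln (1 + \<delta>)" using assms by simp
  have "ln ((1 / (1 + \<delta>)) ^ (mstar lam \<delta> + 1)) < ln (1 - lam)"
    using bounds(1) assms by (intro ln_less_cancel_iff[THEN iffD2]) auto
  moreover have "ln (1 - lam) \<le> ln ((1 / (1 + \<delta>)) ^ mstar lam \<delta>)"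
    using bounds(2) assms by (intro ln_le_cancel_iff[THEN iffD2]) auto
  ultimately have "- (real (mstar lam \<delta> + 1) * ln (1 + \<delta>)) < ln (1 - lam)"
    and "ln (1 - lam) \<le> - (real (mstar lam \<delta>) * ln (1 + \<delta>))"
    unfolding ln_inverse_power[OF assms(1)] .
  then show ?thesis
    using pos by (intro floor_unique[symmetric]) (simp_all add: field_simps)
qed

lemma critical_iff_ln:
  assumes "0 < \<delta>" and "lam < 1"
  shows "lam = 1 - (1 / (1 + \<delta>)) ^ m \<longleftrightarrow> real m = - (ln (1 - lam) / ln (1 + \<delta>))"
proof -
  have "lam = 1 - (1 / (1 + \<delta>)) ^ m \<longleftrightarrow> 1 - lam = (1 / (1 + \<delta>)) ^ m" by auto
  also have "\<dots> \<longleftrightarrow> ln (1 - lam) = ln ((1 / (1 + \<delta>)) ^ m)"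
    using assms by (intro ln_inj_iff[symmetric]) auto
  also have "\<dots> \<longleftrightarrow> real m = - (ln (1 - lam) / ln (1 + \<delta>))"
    using assms by (subst ln_inverse_power) (auto simp: field_simps)
  finally show ?thesis .
qed

text \<open>At \<nu> = 0 one has a = b, and both parts of each entry of column m + 1
  coincide.\<close>

lemma ystar_critical:
  assumes "0 < \<delta>" and "0 < m"
  shows "ystar \<delta> m 0 0 m = (1 / (1 + \<delta>)) ^ m"
    and "i \<in> {1..m} \<Longrightarrow> ystar \<delta> m 0 i m = \<delta> * (1 / (1 + \<delta>)) ^ (m + 1 - i)"
    and "ystar \<delta> m 0 i (m + 1) = 0"
proof -
  define a where "a = 1 / (1 + \<delta>)"
  obtain k where m: "m = Suc k" using assms(2) gr0_conv_Suc by blast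
  have pred: "a powi (int m - 1) = a ^ k" by (simp add: m)
  show "ystar \<delta> m 0 0 m = (1 / (1 + \<delta>)) ^ m"
    using assms(1) unfolding ystar_def Let_def by (simp add: pred flip: a_def) (simp add: m)
  show "ystar \<delta> m 0 i m = \<delta> * (1 / (1 + \<delta>)) ^ (m + 1 - i)" if "i \<in> {1..m}"
    using that unfolding ystar_def Let_def by (simp add: Suc_diff_le flip: a_def)
  have "a ^ (m + 2 - i) = a * a ^ (m + 1 - i)" if "i \<le> m + 1"
    using that by (simp add: Suc_diff_le flip: power_Suc)
  then show "ystar \<delta> m 0 i (m + 1) = 0"
    using assms(1) unfolding ystar_def Let_def
    by (simp add: pred flip: a_def) (simp add: m power2_eq_square)
qed

text \<open>With x = a^m, the m-th root of x is a, and \<delta> a = 1 - a.\<close>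

lemma critical_powr:
  fixes \<delta> :: real
  assumes "0 < \<delta>" and "i \<in> {1..m}"
  defines "x \<equiv> (1 / (1 + \<delta>)) ^ m"
  shows "\<delta> * (1 / (1 + \<delta>)) ^ (m + 1 - i) = (1 - x powr (1 / real m)) * x powr (real (m - i) / real m)"
proof -
  define a where "a = 1 / (1 + \<delta>)"
  have a: "0 < a" "1 - a = \<delta> * a" using assms(1) by (simp_all add: a_def field_simps)
  have "x = a powr real m" using a by (simp add: x_def a_def powr_realpow)
  then have "x powr t = a powr (real m * t)" for t by (simp add: powr_powr)
  then have "x powr (1 / real m) = a" "x powr (real (m - i) / real m) = a ^ (m - i)"
    using a assms(2) by (simp_all add: powr_realpow del: of_nat_diff)
  moreover have "m + 1 - i = Suc (m - i)" using assms(2) by auto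
  ultimately show ?thesis using a by (simp flip: a_def)
qed

theorem proposition5p1:
  fixes lam \<delta> :: real
  assumes "0 < lam" and "lam < 1" and "0 < \<delta>"
  shows
    "let m = mstar lam \<delta> in
       m = Max {k. lam \<ge> 1 - (1 / (1 + \<delta>)) ^ k} \<and>
       int m = \<lfloor>- (ln (1 - lam) / ln (1 + \<delta>))\<rfloor> \<and>
       (\<forall>\<nu>\<ge>0. ystar \<delta> m \<nu> 0 m + ystar \<delta> m \<nu> 0 (m + 1) = hfun \<delta> m \<nu>) \<and>
       (\<exists>!\<nu>. 0 \<le> \<nu> \<and> hfun \<delta> m \<nu> = 1 - lam) \<and>
       (\<forall>\<nu>. 0 \<le> \<nu> \<and> hfun \<delta> m \<nu> = 1 - lam \<longrightarrow>
          fixed_point lam \<delta> (ystar \<delta> m \<nu>) \<and>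
          (\<forall>y. fixed_point lam \<delta> y \<longrightarrow> (\<forall>i j. i \<le> j \<longrightarrow> y i j = ystar \<delta> m \<nu> i j))) \<and>
       (lam = 1 - (1 + \<delta>) powi (- int m) \<longleftrightarrow> real m = - (ln (1 - lam) / ln (1 + \<delta>))) \<and>
       (lam = 1 - (1 + \<delta>) powi (- int m) \<longrightarrow>
          (\<forall>\<nu>. 0 \<le> \<nu> \<and> hfun \<delta> m \<nu> = 1 - lam \<longrightarrow>
             \<nu> = 0 \<and>
             ystar \<delta> m \<nu> 0 m = (1 / (1 + \<delta>)) ^ m \<and>
             (1 / (1 + \<delta>)) ^ m = 1 - lam \<and>
             (\<forall>i\<in>{1..m}.
                ystar \<delta> m \<nu> i m = \<delta> * (1 / (1 + \<delta>)) ^ (m + 1 - i) \<and>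
                \<delta> * (1 / (1 + \<delta>)) ^ (m + 1 - i) =
                  (1 - (1 - lam) powr (1 / real m)) * (1 - lam) powr (real (m - i) / real m)) \<and>
             (\<forall>i\<in>{0..m + 1}. ystar \<delta> m \<nu> i (m + 1) = 0)))"
proof -
  define m where "m = mstar lam \<delta>"
  have lam: "0 \<le> lam" using assms(1) by simp
  note bounds = mstar_bounds[OF assms(3) lam assms(2), folded m_def]
  have powi: "(1 + \<delta>) powi (- int m) = (1 / (1 + \<delta>)) ^ m"
    using assms(3) by (simp add: power_int_minus power_divide inverse_eq_divide)
  have unique: "\<exists>!\<nu>. 0 \<le> \<nu> \<and> hfun \<delta> m \<nu> = 1 - lam"
  proof (rule ex_ex1I)
    show "\<exists>\<nu>. 0 \<le> \<nu> \<and> hfun \<delta> m \<nu> = 1 - lam" using hfun_surj[OF assms(3) bounds] by blast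
    show "\<nu> = \<nu>'" if "0 \<le> \<nu> \<and> hfun \<delta> m \<nu> = 1 - lam" "0 \<le> \<nu>' \<and> hfun \<delta> m \<nu>' = 1 - lam" for \<nu> \<nu>'
      using hfun_inj[OF assms(3), of \<nu> \<nu>' m] that by simp
  qed
  have critical: "\<nu> = 0 \<and>
      ystar \<delta> m \<nu> 0 m = (1 / (1 + \<delta>)) ^ m \<and>
      (1 / (1 + \<delta>)) ^ m = 1 - lam \<and>
      (\<forall>i\<in>{1..m}.
         ystar \<delta> m \<nu> i m = \<delta> * (1 / (1 + \<delta>)) ^ (m + 1 - i) \<and>
         \<delta> * (1 / (1 + \<delta>)) ^ (m + 1 - i) =
           (1 - (1 - lam) powr (1 / real m)) * (1 - lam) powr (real (m - i) / real m)) \<and>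
      (\<forall>i\<in>{0..m + 1}. ystar \<delta> m \<nu> i (m + 1) = 0)"
    if lam_eq: "lam = 1 - (1 / (1 + \<delta>)) ^ m" and \<nu>: "0 \<le> \<nu>" "hfun \<delta> m \<nu> = 1 - lam" for \<nu>
  proof -
    have x: "(1 / (1 + \<delta>)) ^ m = 1 - lam" using lam_eq by simp
    \<comment> \<open>Level 0 would give \<lambda> = 0; so the exponents with denominator m are
      genuine.\<close>
    have "0 < m" using x assms(1) by (cases m) auto
    moreover have "\<nu> = 0"
      using hfun_inj[OF assms(3) \<nu>(1) order_refl, of m] hfun_0[OF assms(3), of m] \<nu>(2) x by simp
    ultimately show ?thesis
      using ystar_critical[OF assms(3)] critical_powr[OF assms(3), of _ m, unfolded x] x by auto
  qed
  have fixed: "\<forall>\<nu>. 0 \<le> \<nu> \<and> hfun \<delta> m \<nu> = 1 - lam \<longrightarrow>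
      fixed_point lam \<delta> (ystar \<delta> m \<nu>) \<and>
      (\<forall>y. fixed_point lam \<delta> y \<longrightarrow> (\<forall>i j. i \<le> j \<longrightarrow> y i j = ystar \<delta> m \<nu> i j))"
    using fixed_point_ystar[OF assms(3)] fixed_point_eq_ystar[OF assms, folded m_def] by simp
  show ?thesis
    unfolding Let_def m_def[symmetric] powi
  proof (intro conjI)
    show "m = Max {k. 1 - (1 / (1 + \<delta>)) ^ k \<le> lam}"
      unfolding m_def using assms by (intro mstar_eq_Max) auto
    show "int m = \<lfloor>- (ln (1 - lam) / ln (1 + \<delta>))\<rfloor>"
      unfolding m_def using assms by (intro mstar_eq_floor) auto
    show "\<forall>\<nu>\<ge>0. ystar \<delta> m \<nu> 0 m + ystar \<delta> m \<nu> 0 (m + 1) = hfun \<delta> m \<nu>"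
      using ystar_idle[OF assms(3)] by simp
    show "lam = 1 - (1 / (1 + \<delta>)) ^ m \<longleftrightarrow> real m = - (ln (1 - lam) / ln (1 + \<delta>))"
      by (rule critical_iff_ln[OF assms(3,2)])
  qed ((rule unique fixed | intro impI allI; elim conjE; rule critical; assumption)+)
qed

end
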